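(* Let $G$ be a graph with $n$ vertices, $m$ edges, maximum degree $\triangle$ and minimum degree $\delta\ge 2$. Then $$HM_1(G)\le\frac{(\triangle+\delta)^2}{4m\triangle\delta}M_1(G)^2.$$ Equality holds if and only if $G$ is a regular graph, or there are exactly $\frac{m\delta}{\triangle+\delta}$ edges $e$ of edge degree $d(e)=2\triangle$ and exactly $\frac{m\triangle}{\triangle+\delta}$ edges $e$ of edge degree $d(e)=2\delta$, where $\triangle+\delta$ divides $m\delta$.
   Context: Graphs are finite (with nonempty vertex set), without loops or multiple edges. For a vertex $u$, $d(u)$ is its degree; $\triangle$ and $\delta$ are the maximum and minimum vertex degree of $G$. For an edge $e=uv$ the edge degree is $d(e)=d(u)+d(v)$. The first Zagreb index is $M_1(G)=\sum_{v\in V(G)}d(v)^2$. The first hyper-Zagreb index is $HM_1(G)=\sum_{e\in E(G)}d(e)^2$. A graph is regular if all its vertices have the same degree. *)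

theory Defs
  imports Complex_Main
begin

text \<open>Finite simple undirected graphs with vertex set \<open>V\<close> and edge set \<open>E\<close>: edges are
  two-element subsets of \<open>V\<close>, which excludes loops and multiple edges.\<close>

definition simple_graph :: "'a set \<Rightarrow> 'a set set \<Rightarrow> bool" where
  "simple_graph V E \<longleftrightarrow> finite V \<and> V \<noteq> {} \<and> (\<forall>e\<in>E. e \<subseteq> V \<and> card e = 2)"

definition degree :: "'a set set \<Rightarrow> 'a \<Rightarrow> nat" where
  "degree E v = card {e \<in> E. v \<in> e}"

definition max_degree :: "'a set \<Rightarrow> 'a set set \<Rightarrow> nat" where
  "max_degree V E = Max (degree E ` V)"

definition min_degree :: "'a set \<Rightarrow> 'a set set \<Rightarrow> nat" where
  "min_degree V E = Min (degree E ` V)"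

text \<open>For an edge \<open>e = {u, v}\<close> this is \<open>d(u) + d(v)\<close>, see \<open>edge_degree_doubleton\<close>.\<close>

definition edge_degree :: "'a set set \<Rightarrow> 'a set \<Rightarrow> nat" where
  "edge_degree E e = (\<Sum>u\<in>e. degree E u)"

lemma edge_degree_doubleton:
  "u \<noteq> v \<Longrightarrow> edge_degree E {u, v} = degree E u + degree E v"
  by (simp add: edge_degree_def)

definition first_zagreb :: "'a set \<Rightarrow> 'a set set \<Rightarrow> nat" where
  "first_zagreb V E = (\<Sum>v\<in>V. (degree E v)\<^sup>2)"

definition first_hyper_zagreb :: "'a set set \<Rightarrow> nat" where
  "first_hyper_zagreb E = (\<Sum>e\<in>E. (edge_degree E e)\<^sup>2)"

definition regular_graph :: "'a set \<Rightarrow> 'a set set \<Rightarrow> bool" where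
  "regular_graph V E \<longleftrightarrow> (\<forall>u\<in>V. \<forall>v\<in>V. degree E u = degree E v)"

end

theory Submission imports Defs begin

text \<open>Each edge degree \<open>x\<close> lies in \<open>[p, q]\<close> with \<open>p = 2\<delta>\<close> and \<open>q = 2\<Delta>\<close>, so
  \<open>(x - p) (q - x) \<ge> 0\<close>. Since the edge degrees sum to \<open>M\<^sub>1\<close>, summation over the edges gives
  \<open>HM\<^sub>1 \<le> (p + q) M\<^sub>1 - m p q\<close>, and by AM-GM the right-hand side is at most
  \<open>(p + q)\<^sup>2 M\<^sub>1\<^sup>2 / (4 m p q)\<close>. Equality forces all edge degrees into \<open>{p, q}\<close> together with
  \<open>(p + q) M\<^sub>1 = 2 m p q\<close>; if \<open>p < q\<close>, this determines how often each value is taken.\<close>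

text \<open>An exact identity is used instead of an estimate so that the equality case can be read
  off later: once all values lie between \<open>p\<close> and \<open>q\<close>, both terms on the
  right are nonnegative. The second term comes from completing the square in the sum of the values,
  which is the AM-GM step with its error kept.\<close>

lemma reverse_Cauchy_Schwarz_gap:
  fixes x :: "'b \<Rightarrow> real"
  assumes "finite A" "A \<noteq> {}" "0 < p" "0 < q"
  defines "N \<equiv> real (card A)"
  shows "(p + q)\<^sup>2 / (4 * N * p * q) * (\<Sum>a\<in>A. x a)\<^sup>2 - (\<Sum>a\<in>A. (x a)\<^sup>2)
    = (\<Sum>a\<in>A. (x a - p) * (q - x a)) + ((p + q) * (\<Sum>a\<in>A. x a) - 2 * N * p * q)\<^sup>2 / (4 * N * p * q)"
proof -
  have "N > 0"
    using assms by (simp add: card_gt_0_iff)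
  have "(x a - p) * (q - x a) = (p + q) * x a - (x a)\<^sup>2 - p * q" for a
    by (simp add: algebra_simps power2_eq_square)
  then have "(\<Sum>a\<in>A. (x a - p) * (q - x a))
      = (p + q) * (\<Sum>a\<in>A. x a) - (\<Sum>a\<in>A. (x a)\<^sup>2) - N * (p * q)"
    by (simp add: sum_subtractf sum_distrib_left N_def)
  moreover have "((p + q) * S - 2 * N * p * q)\<^sup>2 / (4 * N * p * q)
      = (p + q)\<^sup>2 / (4 * N * p * q) * S\<^sup>2 - (p + q) * S + N * (p * q)" for S
    using \<open>N > 0\<close> \<open>0 < p\<close> \<open>0 < q\<close> 
    by (simp add: field_simps power2_eq_square)
  ultimately show ?thesis
    by simp
qed

text \<open>The gap is \<open>P + R\<close> with both parts nonnegative, so equality means that both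
  vanish: \<open>P\<close> vanishes summand by summand, which puts each value at an endpoint, and
  \<open>R\<close> is a square over a positive denominator.\<close>

lemma reverse_Cauchy_Schwarz:
  fixes x :: "'b \<Rightarrow> real"
  assumes "finite A" "A \<noteq> {}" "0 < p" "0 < q" and bnd: "\<And>a. a \<in> A \<Longrightarrow> p \<le> x a \<and> x a \<le> q"
  defines "N \<equiv> real (card A)"
  shows "(\<Sum>a\<in>A. (x a)\<^sup>2) \<le> (p + q)\<^sup>2 / (4 * N * p * q) * (\<Sum>a\<in>A. x a)\<^sup>2"
    and "(\<Sum>a\<in>A. (x a)\<^sup>2) = (p + q)\<^sup>2 / (4 * N * p * q) * (\<Sum>a\<in>A. x a)\<^sup>2 \<longleftrightarrow>
      (\<forall>a\<in>A. x a = p \<or> x a = q) \<and> (p + q) * (\<Sum>a\<in>A. x a) = 2 * N * p * q"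
proof -
  define P where "P = (\<Sum>a\<in>A. (x a - p) * (q - x a))"
  define R where "R = ((p + q) * (\<Sum>a\<in>A. x a) - 2 * N * p * q)\<^sup>2 / (4 * N * p * q)"
  have "N > 0"
    using assms by (simp add: card_gt_0_iff)
  have nonneg: "(x a - p) * (q - x a) \<ge> 0" if "a \<in> A" for a
    using bnd[OF that] by simp
  have "P \<ge> 0"
    unfolding P_def using nonneg by (rule sum_nonneg)
  have "R \<ge> 0"
    unfolding R_def using \<open>N > 0\<close> \<open>0 < p\<close> \<open>0 < q\<close> by simp
  have gap: "(p + q)\<^sup>2 / (4 * N * p * q) * (\<Sum>a\<in>A. x a)\<^sup>2 - (\<Sum>a\<in>A. (x a)\<^sup>2) = P + R"
    unfolding P_def R_def N_def using assms(1-4) by (rule reverse_Cauchy_Schwarz_gap)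
  show "(\<Sum>a\<in>A. (x a)\<^sup>2) \<le> (p + q)\<^sup>2 / (4 * N * p * q) * (\<Sum>a\<in>A. x a)\<^sup>2"
    using gap \<open>P \<ge> 0\<close> \<open>R \<ge> 0\<close> by linarith
  have "P = 0 \<longleftrightarrow> (\<forall>a\<in>A. x a = p \<or> x a = q)"
    unfolding P_def using nonneg \<open>finite A\<close> by (subst sum_nonneg_eq_0_iff) auto
  moreover have "R = 0 \<longleftrightarrow> (p + q) * (\<Sum>a\<in>A. x a) = 2 * N * p * q"
    unfolding R_def using \<open>N > 0\<close> \<open>0 < p\<close> \<open>0 < q\<close> by simp
  ultimately show "(\<Sum>a\<in>A. (x a)\<^sup>2) = (p + q)\<^sup>2 / (4 * N * p * q) * (\<Sum>a\<in>A. x a)\<^sup>2 \<longleftrightarrow>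
      (\<forall>a\<in>A. x a = p \<or> x a = q) \<and> (p + q) * (\<Sum>a\<in>A. x a) = 2 * N * p * q"
    using gap \<open>P \<ge> 0\<close> \<open>R \<ge> 0\<close> by linarith
qed

text \<open>If only \<open>p\<close> and \<open>q\<close> occur, the sizes of the two fibres add up
  to \<open>N\<close>, and the condition on the sum is a second linear equation for them. As
  \<open>p < q\<close>, the fibres are disjoint and the system has exactly one solution.\<close>

lemma two_valued_sum_iff_card:
  fixes x :: "'b \<Rightarrow> real"
  assumes "finite A" "0 < p" "p < q"
  defines "N \<equiv> real (card A)"
  shows "(\<forall>a\<in>A. x a = p \<or> x a = q) \<and> (p + q) * (\<Sum>a\<in>A. x a) = 2 * N * p * q \<longleftrightarrow>
    real (card {a \<in> A. x a = q}) = N * p / (p + q) \<and> real (card {a \<in> A. x a = p}) = N * q / (p + q)"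
    (is "?two \<and> ?sum \<longleftrightarrow> real (card ?Q) = _ \<and> real (card ?P) = _")
proof -
  have union: "real (card (?Q \<union> ?P)) = real (card ?Q) + real (card ?P)"
    using assms by (subst card_Un_disjoint) auto
  have sum: "(\<Sum>a\<in>A. x a) = q * real (card ?Q) + p * real (card ?P)" if ?two
  proof -
    have "A = ?Q \<union> ?P"
      using that by blast
    then have "(\<Sum>a\<in>A. x a) = (\<Sum>a\<in>?Q \<union> ?P. x a)"
      by simp
    also have "\<dots> = (\<Sum>a\<in>?Q. x a) + (\<Sum>a\<in>?P. x a)"
      using assms by (intro sum.union_disjoint) auto
    finally show ?thesis
      by (simp add: mult.commute)
  qed
  show ?thesis
  proof
    assume "?two \<and> ?sum"
    then have ?two ?sum
      by blast+
    then have "A = ?Q \<union> ?P"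
      by blast
    then have N: "N = real (card ?Q) + real (card ?P)"
      using union N_def by simp
    have "(p + q) * (q * real (card ?Q) + p * real (card ?P)) = 2 * N * p * q"
      using \<open>?sum\<close> sum[OF \<open>?two\<close>] by simp
    \<comment> \<open>After substituting the fibre sizes for \<open>N\<close>, the equation reduces
      to \<open>(q - p) * (q * card ?Q - p * card ?P) = 0\<close>; the factor \<open>q - p\<close>
      is kept on both sides here in order to cancel it next.\<close>
    then have "(q - p) * ((p + q) * real (card ?Q)) = (q - p) * (N * p)"
      unfolding N by (simp add: algebra_simps)
    then have "(p + q) * real (card ?Q) = N * p"
      using \<open>p < q\<close> by simp
    moreover from this have "(p + q) * real (card ?P) = N * q"
      unfolding N by (simp add: algebra_simps)
    ultimately show "real (card ?Q) = N * p / (p + q) \<and> real (card ?P) = N * q / (p + q)"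
      using \<open>0 < p\<close> \<open>p < q\<close> by (simp add: field_simps)
  next
    assume cards: "real (card ?Q) = N * p / (p + q) \<and> real (card ?P) = N * q / (p + q)"
    \<comment> \<open>The prescribed sizes add up to \<open>N * (p + q) / (p + q)\<close>, so the
      two fibres together are a subset of \<open>A\<close> of full size and no third value can
      occur.\<close>
    then have "real (card (?Q \<union> ?P)) = N"
      using union \<open>0 < p\<close> \<open>p < q\<close> by (simp add: add_divide_distrib[symmetric] distrib_left[symmetric])
    then have "card (?Q \<union> ?P) = card A"
      by (simp add: N_def)
    then have "?Q \<union> ?P = A"
      using \<open>finite A\<close> by (intro card_subset_eq) auto
    then have two: ?two
      by blast
    have "q * (N * p / (p + q)) + p * (N * q / (p + q)) = 2 * N * p * q / (p + q)"
      by (simp add: add_divide_distrib[symmetric] mult_ac)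
    then have "(p + q) * (q * (N * p / (p + q)) + p * (N * q / (p + q))) = 2 * N * p * q"
      using \<open>0 < p\<close> \<open>p < q\<close> by simp
    then show "?two \<and> ?sum"
      using two sum[OF two] cards by simp
  qed
qed

lemma simple_graph_finite_edges:
  assumes "simple_graph V E"
  shows "finite E"
proof (rule finite_subset)
  show "E \<subseteq> Pow V" "finite (Pow V)"
    using assms by (auto simp: simple_graph_def)
qed

lemma degree_bounds:
  assumes "simple_graph V E" "v \<in> V"
  shows "min_degree V E \<le> degree E v" "degree E v \<le> max_degree V E"
  using assms by (auto simp: simple_graph_def min_degree_def max_degree_def)

lemma edge_degree_bounds:
  assumes "simple_graph V E" "e \<in> E"
  shows "2 * min_degree V E \<le> edge_degree E e" "edge_degree E e \<le> 2 * max_degree V E"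
proof -
  have e: "e \<subseteq> V" "card e = 2"
    using assms by (auto simp: simple_graph_def)
  show "2 * min_degree V E \<le> edge_degree E e"
    unfolding edge_degree_def
    using sum_bounded_below[of e "min_degree V E" "degree E"] degree_bounds[OF assms(1)] e by auto
  show "edge_degree E e \<le> 2 * max_degree V E"
    unfolding edge_degree_def
    using sum_bounded_above[of e "degree E" "max_degree V E"] degree_bounds[OF assms(1)] e by auto
qed

text \<open>Double counting of incidences: a vertex contributes its degree once for each edge at it,
  hence the square of its degree in total.\<close>

lemma sum_edge_degree_eq_first_zagreb:
  assumes "simple_graph V E"
  shows "(\<Sum>e\<in>E. edge_degree E e) = first_zagreb V E"
proof -
  have fin: "finite V" "finite E" and ends: "\<And>e. e \<in> E \<Longrightarrow> {v \<in> V. v \<in> e} = e"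
    using assms simple_graph_finite_edges by (auto simp: simple_graph_def)
  have "(\<Sum>e\<in>E. edge_degree E e) = (\<Sum>e\<in>E. \<Sum>v | v \<in> V \<and> v \<in> e. degree E v)"
    by (simp add: edge_degree_def ends)
  also have "\<dots> = (\<Sum>v\<in>V. \<Sum>e | e \<in> E \<and> v \<in> e. degree E v)"
    using fin by (intro sum.swap_restrict)
  also have "\<dots> = first_zagreb V E"
    by (simp add: first_zagreb_def degree_def power2_eq_square)
  finally show ?thesis .
qed

lemma regular_graph_iff_min_eq_max:
  assumes "simple_graph V E"
  shows "regular_graph V E \<longleftrightarrow> min_degree V E = max_degree V E"
proof
  assume reg: "regular_graph V E"
  obtain v where "v \<in> V"
    using assms by (auto simp: simple_graph_def)
  then have "degree E ` V = {degree E v}"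
    using reg unfolding regular_graph_def by blast
  then show "min_degree V E = max_degree V E"
    by (simp add: min_degree_def max_degree_def)
next
  assume eq: "min_degree V E = max_degree V E"
  have "degree E v = max_degree V E" if "v \<in> V" for v
    using degree_bounds[OF assms that] eq by simp
  then show "regular_graph V E"
    by (simp add: regular_graph_def)
qed

theorem theorem4:
  fixes V :: "'a set" and E :: "'a set set" and n m \<Delta> \<delta> :: nat
  assumes "simple_graph V E"
    and "card V = n"
    and "card E = m"
    and "max_degree V E = \<Delta>"
    and "min_degree V E = \<delta>"
    and "\<delta> \<ge> 2"
  shows "real (first_hyper_zagreb E)
           \<le> (real \<Delta> + real \<delta>)\<^sup>2 / (4 * real m * real \<Delta> * real \<delta>) * (real (first_zagreb V E))\<^sup>2
    \<and> (real (first_hyper_zagreb E)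
           = (real \<Delta> + real \<delta>)\<^sup>2 / (4 * real m * real \<Delta> * real \<delta>) * (real (first_zagreb V E))\<^sup>2
       \<longleftrightarrow> regular_graph V E
         \<or> ((\<Delta> + \<delta>) dvd (m * \<delta>)
            \<and> real (card {e \<in> E. edge_degree E e = 2 * \<Delta>}) = real m * real \<delta> / (real \<Delta> + real \<delta>)
            \<and> real (card {e \<in> E. edge_degree E e = 2 * \<delta>}) = real m * real \<Delta> / (real \<Delta> + real \<delta>)))"
proof -
  define x where "x e = real (edge_degree E e)" for e
  define p q where "p = 2 * real \<delta>" and "q = 2 * real \<Delta>"
  have "finite E"
    using assms(1) by (rule simple_graph_finite_edges)
  obtain v where "v \<in> V"
    using assms(1) by (auto simp: simple_graph_def)
  then have "\<delta> \<le> degree E v" "degree E v \<le> \<Delta>"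
    using degree_bounds[OF assms(1)] assms(4,5) by auto
  \<comment> \<open>A vertex of positive degree has an edge at it; this makes \<open>m\<close>
    positive, so the bound involves no division by zero.\<close>
  then have "\<delta> \<le> \<Delta>" "E \<noteq> {}"
    using \<open>\<delta> \<ge> 2\<close> by (auto simp: degree_def)
  have pq: "0 < p" "0 < q"
    using \<open>\<delta> \<ge> 2\<close> \<open>\<delta> \<le> \<Delta>\<close> by (auto simp: p_def q_def)
  have bnd: "p \<le> x e \<and> x e \<le> q" if "e \<in> E" for e
    using edge_degree_bounds[OF assms(1) that] assms(4,5) by (auto simp: x_def p_def q_def)
  have sum: "(\<Sum>e\<in>E. x e) = real (first_zagreb V E)"
    unfolding x_def sum_edge_degree_eq_first_zagreb[OF assms(1), symmetric] by simp
  have sum_sq: "(\<Sum>e\<in>E. (x e)\<^sup>2) = real (first_hyper_zagreb E)"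
    by (simp add: x_def first_hyper_zagreb_def)
  \<comment> \<open>The constant is homogeneous of degree 0 in \<open>p\<close> and
    \<open>q\<close>, so doubling both minimum and maximum degree leaves it unchanged.\<close>
  have factor: "(p + q)\<^sup>2 / (4 * real m * p * q)
      = (real \<Delta> + real \<delta>)\<^sup>2 / (4 * real m * real \<Delta> * real \<delta>)"
  proof -
    have "(p + q)\<^sup>2 = 4 * (real \<Delta> + real \<delta>)\<^sup>2"
      "4 * real m * p * q = 4 * (4 * real m * real \<Delta> * real \<delta>)"
      by (simp_all add: p_def q_def power2_eq_square algebra_simps)
    then show ?thesis
      by simp
  qed
  note rcs = reverse_Cauchy_Schwarz[of E p q x, OF \<open>finite E\<close> \<open>E \<noteq> {}\<close> pq bnd,
      unfolded assms(3) sum sum_sq factor]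
  have "(\<forall>e\<in>E. x e = p \<or> x e = q) \<and> (p + q) * real (first_zagreb V E) = 2 * real m * p * q \<longleftrightarrow>
      regular_graph V E
         \<or> ((\<Delta> + \<delta>) dvd (m * \<delta>)
            \<and> real (card {e \<in> E. edge_degree E e = 2 * \<Delta>}) = real m * real \<delta> / (real \<Delta> + real \<delta>)
            \<and> real (card {e \<in> E. edge_degree E e = 2 * \<delta>}) = real m * real \<Delta> / (real \<Delta> + real \<delta>))"
    (is "?eq \<longleftrightarrow> _ \<or> ?dvd \<and> ?cardQ \<and> ?cardP")
  \<comment> \<open>For \<open>\<delta> = \<Delta>\<close> the two fibres coincide, so counting them
    separately makes no sense; there the graph is regular and \<open>?eq\<close> holds because every
    edge degree is \<open>p = q\<close>. Otherwise the graph is not regular and the fibre count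
    decides.\<close>
  proof (cases "\<delta> = \<Delta>")
    case True
    then have "x e = p" if "e \<in> E" for e
      using bnd[OF that] by (simp add: p_def q_def)
    moreover from this have "real (first_zagreb V E) = real m * p"
      using assms(3) by (simp add: sum[symmetric])
    ultimately have ?eq
      using True by (simp add: p_def q_def)
    then show ?thesis
      using True regular_graph_iff_min_eq_max[OF assms(1)] assms(4,5) by simp
  next
    case False
    then have "p < q"
      using \<open>\<delta> \<le> \<Delta>\<close> by (simp add: p_def q_def)
    have nreg: "\<not> regular_graph V E"
      using False regular_graph_iff_min_eq_max[OF assms(1)] assms(4,5) by simp
    have "real m * p / (p + q) = real m * real \<delta> / (real \<Delta> + real \<delta>)"
      "real m * q / (p + q) = real m * real \<Delta> / (real \<Delta> + real \<delta>)"
      using pq by (simp_all add: p_def q_def divide_simps)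
    moreover have "x e = q \<longleftrightarrow> edge_degree E e = 2 * \<Delta>" "x e = p \<longleftrightarrow> edge_degree E e = 2 * \<delta>" for e
      unfolding x_def p_def q_def by linarith+
    ultimately have "?eq \<longleftrightarrow> ?cardQ \<and> ?cardP"
      using two_valued_sum_iff_card[of E p q x, OF \<open>finite E\<close> \<open>0 < p\<close> \<open>p < q\<close>]
      unfolding assms(3) sum by simp
    \<comment> \<open>The count is a natural number whose product with
      \<open>\<Delta> + \<delta>\<close> is \<open>m * \<delta>\<close>, so it is itself the witness
      for divisibility.\<close>
    moreover have ?dvd if ?cardQ
    proof -
      have "real (m * \<delta>) = real ((\<Delta> + \<delta>) * card {e \<in> E. edge_degree E e = 2 * \<Delta>})"
        using that \<open>\<delta> \<ge> 2\<close> by (simp add: field_simps)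
      then show ?thesis
        by (metis dvd_triv_left of_nat_eq_iff)
    qed
    ultimately show ?thesis
      using nreg by blast
  qed
  then show ?thesis
    using rcs by blast
qed

end
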